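(* Let $H$ be an $r$-uniform hypergraph. There is a constant $C_H$ such that for every positive integer $n$, \[ \frac{1}{n^{|V(H)|-r}}\,\mathrm{DiscGW}(T_H)\le C_H\,n^{\frac{2r-1}{2}}. \]
   Context: $N=\binom nr$; vectors in $\mathbb R^N$ are indexed by $r$-subsets of $[n]$, and we write $x_{i_1,\dots,i_r}$ for the coordinate of the set $\{i_1,\dots,i_r\}$. Let $V(H)=\{1,\dots,|V(H)|\}$. $T_H:\mathbb R^N\to\mathbb R$, $T_H(x)=\sum\prod_{(s_1,\dots,s_r)\in E(H)}x_{i_{s_1},\dots,i_{s_r}}$, the sum over all $(i_1,\dots,i_{|V(H)|})\in[n]^{|V(H)|}$ with pairwise distinct entries. For $f:\{0,1\}^N\to\mathbb R$, $\mathrm{DiscDerv}_i f(x)=f(x\text{ with }x_i=1)-f(x\text{ with }x_i=0)$, $\mathrm{DiscGrad}f(x)=(\mathrm{DiscDerv}_1f(x),\dots,\mathrm{DiscDerv}_Nf(x))$. The Gaussian width of $K\subseteq\mathbb R^N$ is $\mathbf{GW}(K)=\mathbb E\sup_{y\in K}\langle y,\Gamma\rangle$ with $\Gamma$ standard Gaussian in $\mathbb R^N$, and $\mathrm{DiscGW}(f)=\mathbf{GW}(\{\mathrm{DiscGrad}f(x):x\in\{0,1\}^N\}\cup\{0\})$. *)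

theory Defs
  imports "HOL-Probability.Probability"
begin

definition uniform_hypergraph :: "nat \<Rightarrow> 'a set \<Rightarrow> 'a set set \<Rightarrow> bool" where
  "uniform_hypergraph r V E \<longleftrightarrow> finite V \<and> (\<forall>e\<in>E. e \<subseteq> V \<and> card e = r)"

text \<open>
  \<open>\<real>\<^sup>N\<close> with \<open>N = n choose r\<close> is represented by functions on the index set \<^term>\<open>rsubsets n r\<close>,
  with the value \<^term>\<open>undefined\<close> outside it, as in the product measure below.
\<close>

definition rsubsets :: "nat \<Rightarrow> nat \<Rightarrow> nat set set" where
  "rsubsets n r = {S. S \<subseteq> {1..n} \<and> card S = r}"

text \<open>
  The vertex set is \<open>{1..m}\<close>. A tuple \<open>(i\<^sub>1, \<dots>, i\<^sub>m)\<close> with pairwise distinct entries in \<open>[n]\<close> is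
  an injective function, so the coordinate belonging to an edge \<open>e\<close> is the one of the image of
  \<open>e\<close>, which again has \<open>r\<close> elements.
\<close>

definition T_H :: "nat \<Rightarrow> nat set set \<Rightarrow> nat \<Rightarrow> (nat set \<Rightarrow> real) \<Rightarrow> real" where
  "T_H m E n x = (\<Sum>i\<in>{i \<in> {1..m} \<rightarrow>\<^sub>E {1..n}. inj_on i {1..m}}. \<Prod>e\<in>E. x (i ` e))"

definition DiscDerv :: "'i \<Rightarrow> (('i \<Rightarrow> real) \<Rightarrow> real) \<Rightarrow> ('i \<Rightarrow> real) \<Rightarrow> real" where
  "DiscDerv S f x = f (x(S := 1)) - f (x(S := 0))"

definition DiscGrad :: "'i set \<Rightarrow> (('i \<Rightarrow> real) \<Rightarrow> real) \<Rightarrow> ('i \<Rightarrow> real) \<Rightarrow> ('i \<Rightarrow> real)" where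
  "DiscGrad I f x = (\<lambda>S\<in>I. DiscDerv S f x)"

definition std_gaussian :: "'i set \<Rightarrow> ('i \<Rightarrow> real) measure" where
  "std_gaussian I = (\<Pi>\<^sub>M S\<in>I. density lborel std_normal_density)"

text \<open>
  Real-valued, hence only meaningful if the supremum is finite and integrable; this holds for
  finite nonempty \<open>K\<close> (see below), which is the only case used in \<open>DiscGW\<close>.
\<close>

definition GW :: "'i set \<Rightarrow> ('i \<Rightarrow> real) set \<Rightarrow> real" where
  "GW I K = (\<integral>\<Gamma>. (SUP y\<in>K. \<Sum>S\<in>I. y S * \<Gamma> S) \<partial>std_gaussian I)"

definition DiscGW :: "'i set \<Rightarrow> (('i \<Rightarrow> real) \<Rightarrow> real) \<Rightarrow> real" where
  "DiscGW I f = GW I (DiscGrad I f ` (I \<rightarrow>\<^sub>E {0, 1}) \<union> {\<lambda>S\<in>I. 0})"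

lemma prob_space_std_gaussian: "prob_space (std_gaussian I)"
  unfolding std_gaussian_def
  by (intro prob_space_PiM prob_space_normal_density) simp

lemma integrable_std_gaussian_component:
  assumes "finite I" "S \<in> I"
  shows "integrable (std_gaussian I) (\<lambda>\<Gamma>. \<Gamma> S)"
proof -
  let ?N = "density lborel (\<lambda>x. ennreal (std_normal_density x))"
  have d: "distr (std_gaussian I) ?N (\<lambda>\<Gamma>. \<Gamma> S) = ?N"
    unfolding std_gaussian_def using assms
    by (intro distr_PiM_component prob_space_normal_density) auto
  have m: "(\<lambda>\<Gamma>. \<Gamma> S) \<in> measurable (std_gaussian I) ?N"
    unfolding std_gaussian_def using assms(2) by (rule measurable_component_singleton)
  have "integrable lborel (\<lambda>x. std_normal_density x * x)"
    using integrable_normal_moment[of 1 0 1] by simp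
  then have "integrable ?N (\<lambda>x. x)"
    by (subst integrable_density) auto
  then have "integrable (distr (std_gaussian I) ?N (\<lambda>\<Gamma>. \<Gamma> S)) (\<lambda>x. x)"
    by (simp only: d)
  from integrable_distr[OF m this] show ?thesis .
qed

lemma integrable_GW:
  assumes "finite I" "finite K" "K \<noteq> {}"
  shows "integrable (std_gaussian I) (\<lambda>\<Gamma>. SUP y\<in>K. \<Sum>S\<in>I. y S * \<Gamma> S)"
  using assms(2,3)
proof (induction K rule: finite_ne_induct)
  case (singleton y)
  then show ?case
    using integrable_std_gaussian_component[OF assms(1)] by simp
next
  case (insert y K)
  have "(SUP y\<in>insert y K. \<Sum>S\<in>I. y S * \<Gamma> S) =
      max (\<Sum>S\<in>I. y S * \<Gamma> S) (SUP y\<in>K. \<Sum>S\<in>I. y S * \<Gamma> S)" for \<Gamma>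
    using insert.hyps by (simp add: cSup_insert sup_max)
  moreover have "integrable (std_gaussian I) (\<lambda>\<Gamma>. \<Sum>S\<in>I. y S * \<Gamma> S)"
    using integrable_std_gaussian_component[OF assms(1)] by simp
  ultimately show ?case using insert.IH by simp
qed

end

theory Submission
  imports Defs
begin

text \<open>
  For distinct entries, a coordinate \<open>S\<close> occurs at most once in each monomial of \<open>T_H\<close>, so the
  discrete gradient at \<open>x\<close> is a sum of vectors \<open>a\<close>, one for each edge \<open>e\<close> and each partial
  embedding \<open>k\<close> of the vertices outside \<open>e\<close>; there are at most \<open>|E| n^(m - r)\<close> such pairs. For
  fixed \<open>(e, k)\<close> the vector \<open>a\<close> only depends on the values of \<open>x\<close> at the images of the other
  edges. Each of these meets \<open>e\<close> in at most \<open>r - 1\<close> vertices, so at most \<open>|E| n^(r - 1)\<close>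
  coordinates of \<open>x\<close> matter and \<open>a\<close> takes at most \<open>2^(|E| n^(r - 1))\<close> values. Since also
  \<open>\<parallel>a\<parallel>\<^sup>2 = O(n^r)\<close>, the maximal inequality for finitely many Gaussians bounds the width of the set
  of these vectors by \<open>O(n^((r - 1) / 2) n^(r / 2))\<close>.
\<close>

section \<open>Gaussian exponential moments and width inequalities\<close>

lemma std_normal_mgf:
  fixes c :: real
  shows "integrable (density lborel std_normal_density) (\<lambda>x. exp (c * x))" (is ?I)
    and "(\<integral>x. exp (c * x) \<partial>density lborel std_normal_density) = exp (c\<^sup>2 / 2)" (is ?E)
proof -
  \<comment> \<open>Completing the square: the tilt by \<open>exp (c * x)\<close> moves the mean to
    \<open>c\<close>, and the shifted density has total mass 1.\<close>
  have eq: "std_normal_density x * exp (c * x) = exp (c\<^sup>2 / 2) * normal_density c 1 x" for x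
  proof -
    have "- x\<^sup>2 / 2 + c * x = c\<^sup>2 / 2 - (x - c)\<^sup>2 / 2"
      by (simp add: power2_eq_square field_simps)
    then have "exp (- x\<^sup>2 / 2) * exp (c * x) = exp (c\<^sup>2 / 2) * exp (- (x - c)\<^sup>2 / 2)"
      by (simp add: exp_add[symmetric])
    then show ?thesis by (simp add: normal_density_def)
  qed
  show ?I by (subst integrable_density) (auto simp: eq)
  show ?E by (subst integral_density) (auto simp: eq)
qed

lemma std_gaussian_mgf:
  assumes "finite I"
  shows "integrable (std_gaussian I) (\<lambda>\<Gamma>. exp (\<Sum>S\<in>I. y S * \<Gamma> S))" (is ?I)
    and "(\<integral>\<Gamma>. exp (\<Sum>S\<in>I. y S * \<Gamma> S) \<partial>std_gaussian I) = exp ((\<Sum>S\<in>I. (y S)\<^sup>2) / 2)" (is ?E)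
proof -
  interpret prob_space "density lborel std_normal_density"
    by (rule prob_space_normal_density) simp
  interpret product_sigma_finite "\<lambda>_. density lborel std_normal_density"
    by unfold_locales
  show ?I
    unfolding std_gaussian_def exp_sum[OF assms]
    by (rule product_integrable_prod[OF assms]) (rule std_normal_mgf)
  show ?E
    unfolding std_gaussian_def exp_sum[OF assms]
    by (subst product_integral_prod[OF assms])
      (auto simp: std_normal_mgf exp_sum[OF assms] sum_divide_distrib)
qed

text \<open>The expectation passes through the logarithm because \<open>ln t \<le> ln M + t / M - 1\<close> for all
  positive \<open>t\<close> and \<open>M\<close>; this is applied to the exponential of the supremum with \<open>M\<close> a bound on
  its expectation.\<close>

lemma GW_le:
  assumes I: "finite I" and K: "finite K" "K \<noteq> {}" and l: "l > 0"
    and s: "\<And>y. y \<in> K \<Longrightarrow> (\<Sum>S\<in>I. (y S)\<^sup>2) \<le> s"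
  shows "GW I K \<le> ln (card K) / l + l * s / 2"
proof -
  interpret prob_space "std_gaussian I" by (rule prob_space_std_gaussian)
  let ?g = "\<lambda>y \<Gamma>. \<Sum>S\<in>I. y S * \<Gamma> S"
  let ?e = "\<lambda>\<Gamma>. \<Sum>y\<in>K. exp (\<Sum>S\<in>I. (l * y S) * \<Gamma> S)"
  define M where "M = real (card K) * exp (l\<^sup>2 * s / 2)"
  have cK: "card K > 0" using K by (simp add: card_gt_0_iff)
  then have M: "M > 0" by (simp add: M_def)
  have int: "integrable (std_gaussian I) ?e"
    by (intro Bochner_Integration.integrable_sum std_gaussian_mgf I)
  have "l * (SUP y\<in>K. ?g y \<Gamma>) \<le> ln M - 1 + ?e \<Gamma> / M" for \<Gamma>
  proof -
    \<comment> \<open>On a finite set the supremum is attained, so its scaled exponential is one of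
      the nonnegative summands of \<open>?e\<close>.\<close>
    have "(SUP y\<in>K. ?g y \<Gamma>) \<in> (\<lambda>y. ?g y \<Gamma>) ` K"
      using K by (subst cSup_eq_Max) (auto intro!: Max_in)
    then obtain y where y: "y \<in> K" "(SUP y\<in>K. ?g y \<Gamma>) = ?g y \<Gamma>" by blast
    have "exp (l * ?g y \<Gamma>) = exp (\<Sum>S\<in>I. (l * y S) * \<Gamma> S)"
      by (simp add: sum_distrib_left mult.assoc)
    also have "\<dots> \<le> ?e \<Gamma>"
      using K y(1) by (intro member_le_sum) auto
    finally have 1: "exp (l * ?g y \<Gamma>) \<le> ?e \<Gamma>" .
    have "l * ?g y \<Gamma> - ln M = ln (exp (l * ?g y \<Gamma>) / M)"
      using M by (simp add: ln_div)
    also have "\<dots> \<le> exp (l * ?g y \<Gamma>) / M - 1"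
      using M by (intro ln_le_minus_one) simp
    also have "\<dots> \<le> ?e \<Gamma> / M - 1"
      using 1 M by (simp add: divide_right_mono)
    finally show ?thesis using y by simp
  qed
  then have "(\<integral>\<Gamma>. l * (SUP y\<in>K. ?g y \<Gamma>) \<partial>std_gaussian I)
      \<le> (\<integral>\<Gamma>. ln M - 1 + ?e \<Gamma> / M \<partial>std_gaussian I)"
    using int integrable_GW[OF I K] by (intro integral_mono) auto
  then have "l * GW I K \<le> ln M - 1 + (\<integral>\<Gamma>. ?e \<Gamma> \<partial>std_gaussian I) / M"
    using int by (simp add: GW_def prob_space)
  also have "(\<integral>\<Gamma>. ?e \<Gamma> \<partial>std_gaussian I) = (\<Sum>y\<in>K. exp ((\<Sum>S\<in>I. (l * y S)\<^sup>2) / 2))"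
    by (subst Bochner_Integration.integral_sum)
      (auto intro!: std_gaussian_mgf I simp: std_gaussian_mgf(2)[OF I])
  also have "\<dots> \<le> (\<Sum>y\<in>K. exp (l\<^sup>2 * s / 2))"
    by (intro sum_mono) (auto simp: power_mult_distrib sum_distrib_left[symmetric] s mult_left_mono)
  also have "\<dots> = M" by (simp add: M_def)
  \<comment> \<open>The quotient of the expectation by \<open>M\<close> is at most 1 and is absorbed
    by the -1.\<close>
  finally have "l * GW I K \<le> ln M"
    using M by (simp add: divide_right_mono)
  also have "\<dots> = ln (card K) + l\<^sup>2 * s / 2"
    using cK by (simp add: M_def ln_mult)
  finally show ?thesis
    using l by (simp add: field_simps power2_eq_square)
qed

text \<open>Subadditivity of the width under Minkowski sums: for each fixed \<Gamma>, every summand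
  is bounded by its own supremum. \<open>K\<close> only has to lie inside the sum of the sets
  \<open>L t\<close>, so the choices \<open>z t\<close> may depend on each other, as they do for
  slices of a gradient at a common point.\<close>

lemma GW_le_sum:
  assumes I: "finite I" and K: "finite K" "K \<noteq> {}"
    and L: "\<And>t. t \<in> T \<Longrightarrow> finite (L t)"
    and dec: "\<And>y. y \<in> K \<Longrightarrow> \<exists>z. (\<forall>t\<in>T. z t \<in> L t) \<and> (\<forall>S\<in>I. y S = (\<Sum>t\<in>T. z t S))"
  shows "GW I K \<le> (\<Sum>t\<in>T. GW I (L t))"
proof -
  let ?g = "\<lambda>\<Gamma> y. \<Sum>S\<in>I. y S * \<Gamma> S"
  have ne: "L t \<noteq> {}" if "t \<in> T" for t
    using K(2) dec that by fastforce
  have int: "integrable (std_gaussian I) (\<lambda>\<Gamma>. SUP y\<in>L t. ?g \<Gamma> y)" if "t \<in> T" for t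
    using I L ne that by (intro integrable_GW) auto
  have "(SUP y\<in>K. ?g \<Gamma> y) \<le> (\<Sum>t\<in>T. SUP y\<in>L t. ?g \<Gamma> y)" for \<Gamma>
  proof (rule cSUP_least[OF K(2)])
    fix y assume "y \<in> K"
    then obtain z where z: "\<forall>t\<in>T. z t \<in> L t" "\<forall>S\<in>I. y S = (\<Sum>t\<in>T. z t S)"
      using dec by blast
    have "?g \<Gamma> y = (\<Sum>S\<in>I. \<Sum>t\<in>T. z t S * \<Gamma> S)"
      using z by (simp add: sum_distrib_right)
    also have "\<dots> = (\<Sum>t\<in>T. ?g \<Gamma> (z t))" by (rule sum.swap)
    also have "\<dots> \<le> (\<Sum>t\<in>T. SUP y\<in>L t. ?g \<Gamma> y)"
      using z L by (intro sum_mono cSUP_upper) auto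
    finally show "?g \<Gamma> y \<le> (\<Sum>t\<in>T. SUP y\<in>L t. ?g \<Gamma> y)" .
  qed
  then have "GW I K \<le> (\<integral>\<Gamma>. (\<Sum>t\<in>T. SUP y\<in>L t. ?g \<Gamma> y) \<partial>std_gaussian I)"
    unfolding GW_def using int integrable_GW[OF I K] by (intro integral_mono) auto
  also have "\<dots> = (\<Sum>t\<in>T. GW I (L t))"
    unfolding GW_def using int by (rule Bochner_Integration.integral_sum)
  finally show ?thesis .
qed

section \<open>Decomposition of the discrete gradient into slices\<close>

lemma finite_rsubsets [simp]: "finite (rsubsets n r)"
  by (rule finite_subset[of _ "Pow {1..n}"]) (auto simp: rsubsets_def)

lemma card_rsubsets_le: "card (rsubsets n r) \<le> n ^ r"
proof -
  have "card (rsubsets n r) = n choose r"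
    unfolding rsubsets_def using n_subsets[of "{1..n}" r] by simp
  then show ?thesis by (cases "r \<le> n") (auto intro: binomial_le_pow simp: binomial_eq_0)
qed

definition injections :: "nat \<Rightarrow> nat \<Rightarrow> (nat \<Rightarrow> nat) set" where
  "injections m n = {i \<in> {1..m} \<rightarrow>\<^sub>E {1..n}. inj_on i {1..m}}"

lemma finite_injections [simp]: "finite (injections m n)"
  by (rule finite_subset[of _ "{1..m} \<rightarrow>\<^sub>E {1..n}"]) (auto simp: injections_def intro: finite_PiE)

lemma image_in_rsubsets:
  assumes "i \<in> injections m n" "f \<subseteq> {1..m}" "card f = r"
  shows "i ` f \<in> rsubsets n r"
  using assms unfolding rsubsets_def injections_def
  by (auto simp: card_image inj_on_subset PiE_iff)

definition fibre :: "nat \<Rightarrow> nat \<Rightarrow> nat set \<Rightarrow> (nat \<Rightarrow> nat) \<Rightarrow> (nat \<Rightarrow> nat) set" where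
  "fibre m n e k = {i \<in> injections m n. restrict i ({1..m} - e) = k}"

text \<open>The part of the gradient in which the edge \<open>e\<close> is mapped to the differentiated coordinate
  and the embedding restricts to \<open>k\<close> outside \<open>e\<close>.\<close>

definition slice_grad ::
  "nat \<Rightarrow> nat set set \<Rightarrow> nat \<Rightarrow> nat set \<Rightarrow> (nat \<Rightarrow> nat) \<Rightarrow> (nat set \<Rightarrow> real) \<Rightarrow> nat set \<Rightarrow> real" where
  "slice_grad m E n e k x S = (\<Sum>i\<in>{i \<in> fibre m n e k. i ` e = S}. \<Prod>f\<in>E - {e}. x (i ` f))"

text \<open>At most one edge is mapped to \<open>S\<close>, so the product is affine in that
  coordinate. Its slope is the product over the other edges, whose factors do not see the
  update.\<close>

lemma DiscDerv_prod_image: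
  assumes "finite E" and inj: "inj_on (\<lambda>e. i ` e) E"
  shows "(\<Prod>e\<in>E. (x(S := 1)) (i ` e)) - (\<Prod>e\<in>E. (x(S := 0)) (i ` e))
    = (\<Sum>e\<in>E. if i ` e = S then \<Prod>f\<in>E - {e}. x (i ` f) else (0::real))"
proof (cases "\<exists>e\<in>E. i ` e = S")
  case True
  then obtain d where d: "d \<in> E" "i ` d = S" by blast
  have ne: "i ` f \<noteq> S" if "f \<in> E - {d}" for f
    using that d inj by (auto dest: inj_onD)
  have rest: "(\<Prod>f\<in>E - {d}. (x(S := c)) (i ` f)) = (\<Prod>f\<in>E - {d}. x (i ` f))" for c
    using ne by (intro prod.cong) auto
  have "(\<Sum>e\<in>E. if i ` e = S then \<Prod>f\<in>E - {e}. x (i ` f) else 0) = (\<Prod>f\<in>E - {d}. x (i ` f))"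
    using ne by (subst sum.remove[OF assms(1) d(1)]) (simp add: d)
  then show ?thesis
    by (simp only: prod.remove[OF assms(1) d(1)] rest) (simp add: d)
next
  case False
  then have "(\<Prod>e\<in>E. (x(S := c)) (i ` e)) = (\<Prod>e\<in>E. x (i ` e))" for c
    by (intro prod.cong) auto
  then show ?thesis using False by (simp add: sum.neutral)
qed

lemma DiscDerv_T_H:
  assumes E: "E \<subseteq> Pow {1..m}"
  shows "DiscDerv S (T_H m E n) x =
    (\<Sum>(e, k)\<in>(SIGMA e:E. ({1..m} - e) \<rightarrow>\<^sub>E {1..n}). slice_grad m E n e k x S)"
proof -
  have fE: "finite E" using E by (rule finite_subset) simp
  have inj: "inj_on (\<lambda>e. i ` e) E" if "i \<in> injections m n" for i
    using that E inj_on_image_Pow[of i "{1..m}"]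
    by (auto simp: injections_def intro: inj_on_subset)
  let ?P = "\<lambda>e i. \<Prod>f\<in>E - {e}. x (i ` f)"
  have "DiscDerv S (T_H m E n) x =
      (\<Sum>i\<in>injections m n. \<Sum>e\<in>E. if i ` e = S then ?P e i else 0)"
    unfolding DiscDerv_def T_H_def injections_def[symmetric] sum_subtractf[symmetric]
    by (intro sum.cong refl DiscDerv_prod_image fE inj)
  also have "\<dots> = (\<Sum>e\<in>E. \<Sum>i\<in>injections m n. if i ` e = S then ?P e i else 0)"
    by (rule sum.swap)
  \<comment> \<open>The embeddings are grouped by their restriction outside \<open>e\<close>. Here
    \<open>k\<close> runs through all functions; a non-injective \<open>k\<close> has an empty fibre
    and contributes 0.\<close>
  also have "\<dots> = (\<Sum>e\<in>E. \<Sum>k\<in>({1..m} - e) \<rightarrow>\<^sub>E {1..n}. slice_grad m E n e k x S)"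
  proof (rule sum.cong[OF refl])
    fix e assume "e \<in> E"
    have "(\<lambda>i. restrict i ({1..m} - e)) ` injections m n \<subseteq> ({1..m} - e) \<rightarrow>\<^sub>E {1..n}"
    proof (rule image_subsetI)
      fix i assume "i \<in> injections m n"
      then have "i \<in> {1..m} \<rightarrow>\<^sub>E {1..n}" by (simp add: injections_def)
      then show "restrict i ({1..m} - e) \<in> ({1..m} - e) \<rightarrow>\<^sub>E {1..n}"
        by (intro restrict_PiE_iff[THEN iffD2] ballI) (blast intro: PiE_mem)
    qed
    then have "(\<Sum>i\<in>injections m n. if i ` e = S then ?P e i else 0) =
      (\<Sum>k\<in>({1..m} - e) \<rightarrow>\<^sub>E {1..n}. \<Sum>i\<in>fibre m n e k. if i ` e = S then ?P e i else 0)"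
      unfolding fibre_def
      by (intro sum.group[symmetric] finite_injections finite_PiE) auto
    also have "\<dots> = (\<Sum>k\<in>({1..m} - e) \<rightarrow>\<^sub>E {1..n}. slice_grad m E n e k x S)"
      unfolding slice_grad_def
      by (intro sum.cong refl sum.inter_filter[symmetric]) (simp add: fibre_def)
    finally show "(\<Sum>i\<in>injections m n. if i ` e = S then ?P e i else 0) =
      (\<Sum>k\<in>({1..m} - e) \<rightarrow>\<^sub>E {1..n}. slice_grad m E n e k x S)" .
  qed
  also have "\<dots> = (\<Sum>(e, k)\<in>(SIGMA e:E. ({1..m} - e) \<rightarrow>\<^sub>E {1..n}). slice_grad m E n e k x S)"
    by (rule sum.Sigma) (auto intro: fE finite_PiE)
  finally show ?thesis .
qed

section \<open>Size and number of the slice vectors\<close>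

text \<open>Within a fibre \<open>i\<close> is fixed by \<open>k\<close> outside \<open>e\<close>
  and is \<open>undefined\<close> outside \<open>{1..m}\<close>, so it is determined by its
  restriction to \<open>e\<close>, a map from \<open>e\<close> into \<open>S\<close>.\<close>

lemma card_fibre_image_le:
  assumes "e \<subseteq> {1..m}" "card S = card e" "finite S"
  shows "card {i \<in> fibre m n e k. i ` e = S} \<le> card e ^ card e"
proof -
  have fe: "finite e" using assms(1) by (rule finite_subset) simp
  have "inj_on (\<lambda>i. restrict i e) {i \<in> fibre m n e k. i ` e = S}"
  proof (rule inj_onI, rule ext)
    fix i j v
    assume i: "i \<in> {i \<in> fibre m n e k. i ` e = S}" and j: "j \<in> {i \<in> fibre m n e k. i ` e = S}"
      and eq: "restrict i e = restrict j e"
    have eq': "restrict i ({1..m} - e) = restrict j ({1..m} - e)"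
      using i j by (simp add: fibre_def)
    have "i \<in> extensional {1..m}" "j \<in> extensional {1..m}"
      using i j by (auto simp: fibre_def injections_def PiE_def)
    then show "i v = j v"
      using fun_cong[OF eq, of v] fun_cong[OF eq', of v]
      by (auto simp: extensional_def restrict_def split: if_splits)
  qed
  moreover have "(\<lambda>i. restrict i e) ` {i \<in> fibre m n e k. i ` e = S} \<subseteq> e \<rightarrow>\<^sub>E S"
    by auto
  moreover have "finite (e \<rightarrow>\<^sub>E S)" using fe assms(3) by (intro finite_PiE) auto
  ultimately have "card {i \<in> fibre m n e k. i ` e = S} \<le> card (e \<rightarrow>\<^sub>E S)"
    by (rule card_inj_on_le)
  then show ?thesis using assms(2) fe by (simp add: card_PiE)
qed

lemma slice_grad_bounds:
  assumes e: "e \<subseteq> {1..m}" and S: "card S = card e" "finite S"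
    and x: "\<And>i f. i \<in> injections m n \<Longrightarrow> f \<in> E \<Longrightarrow> x (i ` f) \<in> {0..1}"
  shows "0 \<le> slice_grad m E n e k x S" "slice_grad m E n e k x S \<le> real (card e ^ card e)"
proof -
  have P: "0 \<le> (\<Prod>f\<in>E - {e}. x (i ` f))" "(\<Prod>f\<in>E - {e}. x (i ` f)) \<le> 1"
    if "i \<in> fibre m n e k" for i
    using x that by (auto simp: fibre_def intro!: prod_nonneg prod_le_1)
  then show "0 \<le> slice_grad m E n e k x S"
    unfolding slice_grad_def by (intro sum_nonneg) auto
  have "slice_grad m E n e k x S \<le> of_nat (card {i \<in> fibre m n e k. i ` e = S}) * 1"
    unfolding slice_grad_def using P by (intro sum_bounded_above) auto
  also have "\<dots> \<le> real (card e ^ card e)"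
    using card_fibre_image_le[OF e S] by (simp only: mult_1_right of_nat_le_iff)
  finally show "slice_grad m E n e k x S \<le> real (card e ^ card e)" .
qed

text \<open>The image of \<open>f\<close> is determined by \<open>k\<close> on \<open>f - e\<close>
  and by the values of \<open>i\<close> on \<open>e \<inter> f\<close>. Distinct edges of equal size
  \<open>r\<close> share at most \<open>r - 1\<close> vertices, which leaves at most
  \<open>n ^ (r - 1)\<close> images for each \<open>f\<close>.\<close>

lemma card_fibre_edges_le:
  assumes n: "n \<ge> 1" and H: "uniform_hypergraph r {1..m} E" and e: "e \<in> E"
  shows "card {i ` f | i f. i \<in> fibre m n e k \<and> f \<in> E - {e}} \<le> card E * n ^ (r - 1)"
    and "finite {i ` f | i f. i \<in> fibre m n e k \<and> f \<in> E - {e}}"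
proof -
  let ?Q = "\<lambda>f. (\<lambda>i. i ` f) ` fibre m n e k"
  have sub: "f \<subseteq> {1..m}" "card f = r" if "f \<in> E" for f
    using that H by (auto simp: uniform_hypergraph_def)
  have fE: "finite E" by (rule finite_subset[of _ "Pow {1..m}"]) (use sub in auto)
  have fin: "finite f" if "f \<in> E" for f
    using sub(1)[OF that] by (rule finite_subset) simp
  have Q: "card (?Q f) \<le> n ^ (r - 1)" if f: "f \<in> E - {e}" for f
  proof -
    have "e \<inter> f \<subset> e"
      using f e sub fin by (metis DiffD1 DiffD2 Int_lower1 Int_lower2 card_subset_eq psubsetI singletonI)
    then have "card (e \<inter> f) < r"
      using e sub fin psubset_card_mono by metis
    have "?Q f \<subseteq> (\<lambda>j. j ` (e \<inter> f) \<union> k ` (f - e)) ` ((e \<inter> f) \<rightarrow>\<^sub>E {1..n})"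
    proof
      fix s assume "s \<in> ?Q f"
      then obtain i where i: "i \<in> fibre m n e k" "s = i ` f" by blast
      have "i v = k v" if "v \<in> f - e" for v
        using that i sub(1)[of f] f by (auto simp: fibre_def)
      then have "s = restrict i (e \<inter> f) ` (e \<inter> f) \<union> k ` (f - e)"
        unfolding i(2) by (force simp: image_iff)
      moreover have "restrict i (e \<inter> f) \<in> (e \<inter> f) \<rightarrow>\<^sub>E {1..n}"
        using i(1) sub(1)[OF e] by (auto simp: fibre_def injections_def PiE_iff)
      ultimately show "s \<in> (\<lambda>j. j ` (e \<inter> f) \<union> k ` (f - e)) ` ((e \<inter> f) \<rightarrow>\<^sub>E {1..n})"
        by blast
    qed
    then have "card (?Q f) \<le> card ((e \<inter> f) \<rightarrow>\<^sub>E {1..n})"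
      using fin[OF e] by (intro surj_card_le finite_PiE) auto
    also have "\<dots> = n ^ card (e \<inter> f)" using fin[OF e] by (simp add: card_PiE)
    also have "\<dots> \<le> n ^ (r - 1)"
      using n \<open>card (e \<inter> f) < r\<close> by (intro power_increasing) auto
    finally show ?thesis .
  qed
  have eq: "{i ` f | i f. i \<in> fibre m n e k \<and> f \<in> E - {e}} = (\<Union>f\<in>E - {e}. ?Q f)" by blast
  have "card (\<Union>f\<in>E - {e}. ?Q f) \<le> (\<Sum>f\<in>E - {e}. card (?Q f))"
    using fE by (intro card_UN_le) auto
  also have "\<dots> \<le> of_nat (card (E - {e})) * n ^ (r - 1)"
    using Q by (rule sum_bounded_above)
  also have "\<dots> \<le> card E * n ^ (r - 1)"
    using fE by (simp add: card_Diff1_le)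
  finally show "card {i ` f | i f. i \<in> fibre m n e k \<and> f \<in> E - {e}} \<le> card E * n ^ (r - 1)"
    by (simp only: eq)
  show "finite {i ` f | i f. i \<in> fibre m n e k \<and> f \<in> E - {e}}"
    unfolding eq using fE by (auto simp: fibre_def)
qed

lemma card_slice_grads_le:
  assumes n: "n \<ge> 1" and H: "uniform_hypergraph r {1..m} E" and e: "e \<in> E"
  shows "card (slice_grad m E n e k ` (rsubsets n r \<rightarrow>\<^sub>E {0, 1})) \<le> 2 ^ (card E * n ^ (r - 1))"
proof -
  define Q where "Q = {i ` f | i f. i \<in> fibre m n e k \<and> f \<in> E - {e}}"
  note Q = card_fibre_edges_le[OF assms, of k, folded Q_def]
  have QI: "Q \<subseteq> rsubsets n r"
  proof
    fix s assume "s \<in> Q"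
    then obtain i f where i: "i \<in> injections m n" and f: "f \<in> E" and s: "s = i ` f"
      by (auto simp: Q_def fibre_def)
    have "f \<subseteq> {1..m}" "card f = r" using H f by (auto simp: uniform_hypergraph_def)
    then show "s \<in> rsubsets n r"
      unfolding s by (rule image_in_rsubsets[OF i])
  qed
  \<comment> \<open>The restriction is \<open>undefined\<close> outside \<open>Q\<close>, but every
    factor of the slice is evaluated at an index in \<open>Q\<close>.\<close>
  have "slice_grad m E n e k x = slice_grad m E n e k (restrict x Q)" for x
    unfolding slice_grad_def by (intro ext sum.cong prod.cong refl) (auto simp: Q_def)
  then have "slice_grad m E n e k ` (rsubsets n r \<rightarrow>\<^sub>E {0, 1}) \<subseteq> slice_grad m E n e k ` (Q \<rightarrow>\<^sub>E {0, 1})"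
    using QI by (force simp: PiE_iff)
  then have "card (slice_grad m E n e k ` (rsubsets n r \<rightarrow>\<^sub>E {0, 1})) \<le> card (Q \<rightarrow>\<^sub>E {0, 1::real})"
    using Q(2) by (intro surj_card_le finite_PiE) auto
  also have "\<dots> = 2 ^ card Q" using Q(2) by (simp add: card_PiE numeral_2_eq_2)
  also have "\<dots> \<le> 2 ^ (card E * n ^ (r - 1))" using Q(1) by (intro power_increasing) auto
  finally show ?thesis .
qed

section \<open>Width of one slice and summation over all slices\<close>

text \<open>\<open>GW_le\<close> is applied with log-cardinality of order \<open>n ^ (r - 1)\<close>
  and squared norms of order \<open>n ^ r\<close>. The zero vector is adjoined so that the zero
  element in \<open>DiscGW\<close> also splits over the slices.\<close>

lemma GW_slice_grads_le:
  assumes n: "n \<ge> 1" and r: "r \<ge> 1" and H: "uniform_hypergraph r {1..m} E" and e: "e \<in> E"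
  shows "GW (rsubsets n r) (insert (\<lambda>_. 0) (slice_grad m E n e k ` (rsubsets n r \<rightarrow>\<^sub>E {0, 1})))
    \<le> (real (card E) + 1 + real r ^ (2 * r)) * real n powr ((2 * real r - 1) / 2)"
proof -
  let ?A = "slice_grad m E n e k ` (rsubsets n r \<rightarrow>\<^sub>E {0, 1})"
  let ?K = "insert (\<lambda>_. 0) ?A"
  let ?p = "real n powr ((2 * real r - 1) / 2)"
  \<comment> \<open>up to constants, the optimal parameter in the maximal inequality\<close>
  define l where "l = real n powr (- 1 / 2)"
  have er: "e \<subseteq> {1..m}" "card e = r" using H e by (auto simp: uniform_hypergraph_def)
  have fA: "finite ?A" by (intro finite_imageI finite_PiE) auto
  have l: "l > 0" using n by (simp add: l_def)
  have s: "(\<Sum>S\<in>rsubsets n r. (y S)\<^sup>2) \<le> real n ^ r * real r ^ (2 * r)" if "y \<in> ?K" for y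
  proof -
    have "(y S)\<^sup>2 \<le> real r ^ (2 * r)" if S: "S \<in> rsubsets n r" for S
    proof (cases "y = (\<lambda>_. 0)")
      case False
      then obtain x where x: "x \<in> rsubsets n r \<rightarrow>\<^sub>E {0, 1}" "y = slice_grad m E n e k x"
        using \<open>y \<in> ?K\<close> by blast
      have "x (i ` f) \<in> {0..1}" if i: "i \<in> injections m n" and f: "f \<in> E" for i f
      proof -
        have "f \<subseteq> {1..m}" "card f = r" using H f by (auto simp: uniform_hypergraph_def)
        then have "i ` f \<in> rsubsets n r" by (rule image_in_rsubsets[OF i])
        then have "x (i ` f) \<in> {0, 1}" using x(1) by (rule PiE_mem[rotated])
        then show ?thesis by auto
      qed
      moreover have "card S = card e" "finite S"
        using S er by (auto simp: rsubsets_def intro: finite_subset)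
      ultimately have "0 \<le> y S" "y S \<le> real (r ^ r)"
        using slice_grad_bounds[OF er(1), of S n E x k] er(2) unfolding x(2) by auto
      then have "(y S)\<^sup>2 \<le> (real (r ^ r))\<^sup>2" by (intro power_mono)
      then show ?thesis by (simp add: power_mult[symmetric] mult.commute)
    qed simp
    then have "(\<Sum>S\<in>rsubsets n r. (y S)\<^sup>2) \<le> of_nat (card (rsubsets n r)) * real r ^ (2 * r)"
      by (rule sum_bounded_above)
    also have "\<dots> \<le> real (n ^ r) * real r ^ (2 * r)"
      using card_rsubsets_le[of n r] by (intro mult_right_mono) (auto simp del: of_nat_power)
    finally show ?thesis by simp
  qed
  \<comment> \<open>The extra zero vector costs one doubling, and the added 1 in the exponent is
    absorbed into the factor \<open>card E + 1\<close> because \<open>n ^ (r - 1)\<close> is at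
    least 1.\<close>
  have "card ?K \<le> 1 + card ?A" using fA by (simp add: card_insert_if)
  also have "\<dots> \<le> 2 ^ (card E * n ^ (r - 1) + 1)"
    using card_slice_grads_le[OF n H e, of k] one_le_power[of "2::nat" "card E * n ^ (r - 1)"]
    unfolding power_add power_one_right by linarith
  also have "\<dots> \<le> 2 ^ ((card E + 1) * n ^ (r - 1))"
    using n by (intro power_increasing) (auto simp: algebra_simps)
  finally have "real (card ?K) \<le> real (2 ^ ((card E + 1) * n ^ (r - 1)))"
    by (simp only: of_nat_le_iff)
  then have "ln (card ?K) \<le> ln (2 ^ ((card E + 1) * n ^ (r - 1)))"
    using fA by (subst ln_le_cancel_iff) (auto simp: card_gt_0_iff)
  also have "\<dots> = real ((card E + 1) * n ^ (r - 1)) * ln 2"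
    by (simp add: ln_realpow)
  also have "\<dots> \<le> real ((card E + 1) * n ^ (r - 1)) * 1"
    using ln_2_less_1 by (intro mult_left_mono) auto
  finally have c: "ln (card ?K) \<le> real (card E + 1) * real n ^ (r - 1)"
    by (simp add: algebra_simps)
  \<comment> \<open>With this \<open>l\<close> both terms have exponent r - 1/2; r >= 1 ensures that
    the truncated \<open>r - 1\<close> is the real difference.\<close>
  have p1: "real n ^ (r - 1) / l = ?p"
    using n r by (simp add: l_def powr_realpow[symmetric] powr_diff[symmetric] of_nat_diff field_simps)
  have p2: "l * real n ^ r = ?p"
    using n by (simp add: l_def powr_realpow[symmetric] powr_add[symmetric] field_simps)
  have "GW (rsubsets n r) ?K \<le> ln (card ?K) / l + l * (real n ^ r * real r ^ (2 * r)) / 2"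
    using fA l s by (intro GW_le) auto
  also have "\<dots> \<le> real (card E + 1) * real n ^ (r - 1) / l + l * (real n ^ r * real r ^ (2 * r))"
    using c l by (intro add_mono divide_right_mono) auto
  also have "\<dots> = real (card E + 1) * (real n ^ (r - 1) / l) + (l * real n ^ r) * real r ^ (2 * r)"
    by simp
  also have "\<dots> = (real (card E) + 1 + real r ^ (2 * r)) * ?p"
    unfolding p1 p2 by (simp add: algebra_simps)
  finally show ?thesis .
qed

theorem theoremA4:
  fixes r m :: nat and E :: "nat set set"
  assumes "r \<ge> 1" and "uniform_hypergraph r {1..m} E"
  shows "\<exists>C::real. \<forall>n::nat. n \<ge> 1 \<longrightarrow>
    1 / (real n powi (int m - int r)) * DiscGW (rsubsets n r) (T_H m E n)
      \<le> C * real n powr ((2 * real r - 1) / 2)"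
proof -
  let ?D = "real (card E) + 1 + real r ^ (2 * r)"
  have sub: "E \<subseteq> Pow {1..m}" and cr: "\<And>e. e \<in> E \<Longrightarrow> card e = r"
    using assms(2) by (auto simp: uniform_hypergraph_def)
  have fE: "finite E" using sub by (rule finite_subset) simp
  have "1 / (real n powi (int m - int r)) * DiscGW (rsubsets n r) (T_H m E n)
      \<le> card E * ?D * real n powr ((2 * real r - 1) / 2)" if n: "n \<ge> 1" for n
  proof -
    let ?I = "rsubsets n r"
    let ?p = "real n powr ((2 * real r - 1) / 2)"
    let ?T = "SIGMA e:E. ({1..m} - e) \<rightarrow>\<^sub>E {1..n}"
    let ?L = "\<lambda>(e, k). insert (\<lambda>_. 0) (slice_grad m E n e k ` (?I \<rightarrow>\<^sub>E {0, 1}))"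
    have fin: "finite (?I \<rightarrow>\<^sub>E {0, 1::real})" by (intro finite_PiE) auto
    have "DiscGW ?I (T_H m E n) \<le> (\<Sum>t\<in>?T. GW ?I (?L t))"
      unfolding DiscGW_def
    proof (rule GW_le_sum)
      fix y assume "y \<in> DiscGrad ?I (T_H m E n) ` (?I \<rightarrow>\<^sub>E {0, 1}) \<union> {\<lambda>S\<in>?I. 0}"
      then consider "y = (\<lambda>S\<in>?I. 0)"
        | x where "x \<in> ?I \<rightarrow>\<^sub>E {0, 1}" "y = DiscGrad ?I (T_H m E n) x" by blast
      then show "\<exists>z. (\<forall>t\<in>?T. z t \<in> ?L t) \<and> (\<forall>S\<in>?I. y S = (\<Sum>t\<in>?T. z t S))"
      proof cases
        case 1
        then show ?thesis by (intro exI[of _ "\<lambda>_ _. 0"]) auto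
      next
        case 2
        then show ?thesis
          by (intro exI[of _ "\<lambda>(e, k). slice_grad m E n e k x"])
            (auto simp: DiscGrad_def DiscDerv_T_H[OF sub] case_prod_unfold)
      qed
    qed (use fin in auto)
    also have "\<dots> \<le> of_nat (card ?T) * (?D * ?p)"
      by (intro sum_bounded_above) (auto intro!: GW_slice_grads_le n assms)
    \<comment> \<open>Each edge leaves \<open>m - r\<close> vertices to be placed freely; this is
      the power of \<open>n\<close> removed by the normalisation.\<close>
    also have "card ?T = card E * n ^ (m - r)"
    proof -
      have "card (({1..m} - e) \<rightarrow>\<^sub>E {1..n}) = n ^ (m - r)" if "e \<in> E" for e
        using that sub cr by (subst card_PiE) (auto simp: card_Diff_subset finite_subset)
      then show ?thesis by (simp add: card_SigmaI fE finite_PiE)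
    qed
    finally have *: "DiscGW ?I (T_H m E n) \<le> real n ^ (m - r) * (card E * ?D * ?p)"
      by (simp add: algebra_simps)
    show ?thesis
    \<comment> \<open>Without edges \<open>m < r\<close> is possible, and the truncated
      \<open>m - r\<close> may differ from the integer exponent; the bound \<open>*\<close> is then
      0, so dividing by a nonnegative power preserves it. An edge forces \<open>r \<le> m\<close>,
      and the two exponents agree.\<close>
    proof (cases "E = {}")
      case True
      then show ?thesis using * by (simp add: mult_nonneg_nonpos divide_nonpos_nonneg)
    next
      case False
      then obtain e where "e \<in> E" by blast
      then have "r \<le> m" using sub cr[of e] card_mono[of "{1..m}" e] by auto
      then have "real n powi (int m - int r) = real n ^ (m - r)"
        by (simp add: power_int_def nat_diff_distrib)
      then show ?thesis using * n by (simp add: field_simps)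
    qed
  qed
  then show ?thesis by blast
qed

end
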